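(* Let $f:\mathbb{R}^n\to\mathbb{R}$ be continuously differentiable, $\varphi:\mathbb{R}^n\to\mathbb{R}$ convex, and $\psi:=f+\varphi$. Let $\{x^k\}$ be an (infinite) sequence generated by the regularized proximal quasi-Newton method described in the context, none of whose iterates is a stationary point of $\psi$. Assume that the matrices $B_k$ used in the method form a bounded sequence of symmetric matrices, that $\psi$ is bounded from below, and that $\nabla f$ is uniformly continuous on a set $X\subset\mathbb{R}^n$ satisfying $\{x^k\}\subset X$. Then $$\lim_{k\to\infty}\|r(x^k)\|=0;$$ in particular, every accumulation point of $\{x^k\}$ is a stationary point of $\psi$.
   Context: $\|\cdot\|$ is the Euclidean norm. For a symmetric positive definite $H\in\mathbb{R}^{n\times n}$, $\operatorname{prox}_\varphi^H(x):=\arg\min_y\{\varphi(y)+\tfrac12(y-x)^TH(y-x)\}$, and $r_H(x):=\arg\min_d\{\nabla f(x)^Td+\tfrac12d^THd+\varphi(x+d)\}=\operatorname{prox}_\varphi^H(x-H^{-1}\nabla f(x))-x$; moreover $r(x):=r_I(x)$ with $I$ the identity matrix. A point $x^*$ is a stationary point of $\psi$ if $0\in\nabla f(x^* )+\partial\varphi(x^* )$, where $\partial\varphi$ is the convex subdifferential (equivalently $r(x^* )=0$). Regularized proximal quasi-Newton method. Choose $x^0\in\mathbb{R}^n$ and parameters $\mu_0>0$, $p_{\min}\in(0,\tfrac12)$, $c_1\in(0,\tfrac12)$, $c_2\in(c_1,1)$, $\sigma_1\in(0,1)$, $\sigma_2>1$. For $k=0,1,2,\dots$: choose $B_k\in\mathbb{R}^{n\times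 n}$, put $q_k(d):=f(x^k)+\nabla f(x^k)^Td+\tfrac12d^TB_kd+\varphi(x^k+d)$ and $\hat q_k(d):=q_k(d)+\tfrac12\mu_k\|d\|^2$, and let $d^k$ be a solution (global minimizer) of $\min_d\hat q_k(d)$, if one exists. Define $\operatorname{pred}_k:=\psi(x^k)-q_k(d^k)$ and $\operatorname{ared}_k:=\psi(x^k)-\psi(x^k+d^k)$. (i) If $\min_d\hat q_k(d)$ has no solution, or if $\operatorname{pred}_k\le p_{\min}\|d^k\|\,\|r(x^k)\|$, set $x^{k+1}:=x^k$ and $\mu_{k+1}:=\sigma_2\mu_k$. (ii) Otherwise set $\rho_k:=\operatorname{ared}_k/\operatorname{pred}_k$; set $x^{k+1}:=x^k$ if $\rho_k\le c_1$ and $x^{k+1}:=x^k+d^k$ otherwise; set $\mu_{k+1}:=\sigma_2\mu_k$ if $\rho_k\le c_1$, $\mu_{k+1}:=\mu_k$ if $c_1<\rho_k\le c_2$, and $\mu_{k+1}:=\sigma_1\mu_k$ if $\rho_k>c_2$. The method is run without stopping, producing an infinite sequence. *)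

theory Defs
  imports "HOL-Analysis.Analysis"
begin

text \<open>
  Throughout, \<open>f'\<close> stands for the gradient map of the smooth part \<open>f\<close>, and \<open>\<phi>\<close> for the
  convex part of the composite objective \<open>f + \<phi>\<close>.
\<close>

definition subdifferential :: "('a::real_inner \<Rightarrow> real) \<Rightarrow> 'a \<Rightarrow> 'a set" where
  "subdifferential \<phi> x = {v. \<forall>y. \<phi> y \<ge> \<phi> x + v \<bullet> (y - x)}"

definition stationary_point :: "('a::real_inner \<Rightarrow> 'a) \<Rightarrow> ('a \<Rightarrow> real) \<Rightarrow> 'a \<Rightarrow> bool" where
  "stationary_point f' \<phi> x \<longleftrightarrow> 0 \<in> (\<lambda>v. f' x + v) ` subdifferential \<phi> x"

text \<open>
  The prox-residual \<open>r\<^sub>H\<close>. For symmetric positive definite \<open>H\<close> and convex real-valued \<open>\<phi>\<close> the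
  minimized function is continuous, strongly convex and coercive, so the minimizer exists and is
  unique and the choice made by \<^const>\<open>arg_min\<close> is immaterial.
\<close>

definition prox_residual ::
  "real^'n^'n \<Rightarrow> (real^'n \<Rightarrow> real^'n) \<Rightarrow> (real^'n \<Rightarrow> real) \<Rightarrow> real^'n \<Rightarrow> real^'n" where
  "prox_residual H f' \<phi> x =
     arg_min (\<lambda>d. f' x \<bullet> d + 1/2 * (d \<bullet> (H *v d)) + \<phi> (x + d)) (\<lambda>_. True)"

definition residual :: "(real^'n \<Rightarrow> real^'n) \<Rightarrow> (real^'n \<Rightarrow> real) \<Rightarrow> real^'n \<Rightarrow> real^'n" where
  "residual = prox_residual (mat 1)"

definition model ::
  "(real^'n \<Rightarrow> real) \<Rightarrow> (real^'n \<Rightarrow> real^'n) \<Rightarrow> (real^'n \<Rightarrow> real) \<Rightarrow>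
   real^'n^'n \<Rightarrow> real^'n \<Rightarrow> real^'n \<Rightarrow> real" where
  "model f f' \<phi> B x d = f x + f' x \<bullet> d + 1/2 * (d \<bullet> (B *v d)) + \<phi> (x + d)"

definition reg_model ::
  "(real^'n \<Rightarrow> real) \<Rightarrow> (real^'n \<Rightarrow> real^'n) \<Rightarrow> (real^'n \<Rightarrow> real) \<Rightarrow>
   real^'n^'n \<Rightarrow> real \<Rightarrow> real^'n \<Rightarrow> real^'n \<Rightarrow> real" where
  "reg_model f f' \<phi> B \<mu> x d = model f f' \<phi> B x d + 1/2 * \<mu> * (norm d)\<^sup>2"

definition solves_subproblem ::
  "(real^'n \<Rightarrow> real) \<Rightarrow> (real^'n \<Rightarrow> real^'n) \<Rightarrow> (real^'n \<Rightarrow> real) \<Rightarrow>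
   real^'n^'n \<Rightarrow> real \<Rightarrow> real^'n \<Rightarrow> real^'n \<Rightarrow> bool" where
  "solves_subproblem f f' \<phi> B \<mu> x d \<longleftrightarrow> is_arg_min (reg_model f f' \<phi> B \<mu> x) (\<lambda>_. True) d"

definition pred_red ::
  "(real^'n \<Rightarrow> real) \<Rightarrow> (real^'n \<Rightarrow> real^'n) \<Rightarrow> (real^'n \<Rightarrow> real) \<Rightarrow>
   real^'n^'n \<Rightarrow> real^'n \<Rightarrow> real^'n \<Rightarrow> real" where
  "pred_red f f' \<phi> B x d = (f x + \<phi> x) - model f f' \<phi> B x d"

definition actual_red ::
  "(real^'n \<Rightarrow> real) \<Rightarrow> (real^'n \<Rightarrow> real) \<Rightarrow> real^'n \<Rightarrow> real^'n \<Rightarrow> real" where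
  "actual_red f \<phi> x d = (f x + \<phi> x) - (f (x + d) + \<phi> (x + d))"

text \<open>
  One iteration, relating the state \<open>(x, \<mu>)\<close> to its successor \<open>(x', \<mu>')\<close> for the matrix \<open>B\<close> and the
  direction \<open>d\<close>. The direction is an arbitrary global minimizer if there is one; if the subproblem
  has no solution, \<open>d\<close> is unconstrained, but then it has no influence on the successor state.
\<close>

definition rpqn_step ::
  "(real^'n \<Rightarrow> real) \<Rightarrow> (real^'n \<Rightarrow> real^'n) \<Rightarrow> (real^'n \<Rightarrow> real) \<Rightarrow>
   real \<Rightarrow> real \<Rightarrow> real \<Rightarrow> real \<Rightarrow> real \<Rightarrow>
   real^'n^'n \<Rightarrow> real^'n \<Rightarrow> real^'n \<Rightarrow> real \<Rightarrow> real^'n \<Rightarrow> real \<Rightarrow> bool" where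
  "rpqn_step f f' \<phi> p_min c\<^sub>1 c\<^sub>2 \<sigma>\<^sub>1 \<sigma>\<^sub>2 B d x \<mu> x' \<mu>' \<longleftrightarrow>
     (let solvable = (\<exists>s. solves_subproblem f f' \<phi> B \<mu> x s);
          pred = pred_red f f' \<phi> B x d;
          \<rho> = actual_red f \<phi> x d / pred
      in (solvable \<longrightarrow> solves_subproblem f f' \<phi> B \<mu> x d) \<and>
         (if \<not> solvable \<or> pred \<le> p_min * norm d * norm (residual f' \<phi> x)
          then x' = x \<and> \<mu>' = \<sigma>\<^sub>2 * \<mu>
          else x' = (if \<rho> \<le> c\<^sub>1 then x else x + d) \<and>
               \<mu>' = (if \<rho> \<le> c\<^sub>1 then \<sigma>\<^sub>2 * \<mu> else if \<rho> \<le> c\<^sub>2 then \<mu> else \<sigma>\<^sub>1 * \<mu>)))"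

text \<open>
  The starting point is \<open>x 0\<close> and the initial regularization parameter is \<open>\<mu> 0\<close>.
\<close>

definition rpqn_sequence ::
  "(real^'n \<Rightarrow> real) \<Rightarrow> (real^'n \<Rightarrow> real^'n) \<Rightarrow> (real^'n \<Rightarrow> real) \<Rightarrow>
   real \<Rightarrow> real \<Rightarrow> real \<Rightarrow> real \<Rightarrow> real \<Rightarrow>
   (nat \<Rightarrow> real^'n^'n) \<Rightarrow> (nat \<Rightarrow> real^'n) \<Rightarrow> (nat \<Rightarrow> real^'n) \<Rightarrow> (nat \<Rightarrow> real) \<Rightarrow> bool" where
  "rpqn_sequence f f' \<phi> p_min c\<^sub>1 c\<^sub>2 \<sigma>\<^sub>1 \<sigma>\<^sub>2 B d x \<mu> \<longleftrightarrow>
     (\<forall>k. rpqn_step f f' \<phi> p_min c\<^sub>1 c\<^sub>2 \<sigma>\<^sub>1 \<sigma>\<^sub>2 (B k) (d k) (x k) (\<mu> k) (x (Suc k)) (\<mu> (Suc k)))"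

end

theory Submission
  imports Defs
begin

text \<open>
  Every step of the method decreases the objective \<open>\<psi> = f + \<phi>\<close> by at least a constant times
  \<open>\<parallel>r(x\<^sup>k)\<parallel> \<parallel>x\<^sup>k\<^sup>+\<^sup>1 - x\<^sup>k\<parallel>\<close> (lemma \<open>rpqn_step_descent\<close>): a rejected step does not move, and an
  accepted one passes both the predicted-reduction test and the ratio test. As \<open>\<psi>\<close> is bounded
  below, the path along which the residual stays above a fixed threshold has finite length, and its
  tails are arbitrarily short.

  The first consequence is that the residual cannot stay above some \<open>\<epsilon> > 0\<close> from some index on
  (\<open>residual_frequently_small\<close>). Otherwise the iterates converge to a point \<open>z\<close>. Near \<open>z\<close>
  every step with a sufficiently large regularization parameter is accepted
  (\<open>accepted_near_point\<close>), so the parameters stay bounded. But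
  \<open>\<parallel>r(x)\<parallel> \<le> 2 (1 + \<beta> + \<mu>) \<parallel>d\<parallel>\<close> for every solution \<open>d\<close> of the subproblem (\<open>residual_le_direction\<close>),
  so accepted steps have lengths bounded away from zero. Since the iterates converge, almost all
  steps are rejected, and then the parameters grow geometrically, a contradiction.

  The second consequence is the full limit (\<open>residual_tendsto_zero\<close>). Whenever the residual is at
  least \<open>\<epsilon>\<close>, it falls below \<open>\<epsilon> / 2\<close> later on, and the path in between is arbitrarily short for late
  iterates. This contradicts uniform continuity of the residual along the iterates, which it
  inherits from \<open>f'\<close> through \<open>\<parallel>r(x) - r(y)\<parallel> \<le> \<parallel>f'(x) - f'(y)\<parallel> + 2 \<parallel>x - y\<parallel>\<close>
  (\<open>residual_diff_le\<close>). Uniform continuity is used at iterates only: trial points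
  \<open>x\<^sup>k + d\<^sup>k\<close> enter only in the first part, near \<open>z\<close>, where continuity at \<open>z\<close> suffices. Since
  \<open>r\<close> is continuous, it vanishes at every accumulation point, and its first-order condition there is
  stationarity.

  Both estimates of the residual come from one fact: the two first-order conditions of two
  minimizers of quadratic-plus-convex models add up to a monotonicity inequality in which \<open>\<phi>\<close> no
  longer occurs (\<open>composite_model_minimizers_monotone\<close>).
\<close>

section \<open>Minimizers of a quadratic plus a convex function\<close>

text \<open>
  The residual and the regularized subproblem both minimize a function of this form, for the
  operators \<open>A d = d\<close> and \<open>A d = B d + \<mu> d\<close> respectively, so existence and optimality
  conditions are derived once for a general operator.
\<close>

definition composite_model ::
  "('a::real_inner \<Rightarrow> real) \<Rightarrow> 'a \<Rightarrow> 'a \<Rightarrow> ('a \<Rightarrow> 'a) \<Rightarrow> 'a \<Rightarrow> real" where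
  "composite_model \<phi> x g A d = g \<bullet> d + 1/2 * (d \<bullet> A d) + \<phi> (x + d)"

text \<open>
  The point \<open>x\<close> lies on the segment from \<open>x - d / \<parallel>d\<parallel>\<close>, where \<open>\<phi>\<close> is at most \<open>\<phi> x + L\<close>, to
  \<open>x + d\<close>, so convexity bounds \<open>\<phi> (x + d)\<close> from below. This replaces a
  subgradient at \<open>x\<close>; it has the advantage that \<open>L\<close> can be chosen uniformly for nearby \<open>x\<close>.
\<close>

lemma convex_on_UNIV_linear_lower_bound:
  fixes \<phi> :: "'a::real_inner \<Rightarrow> real"
  assumes convex: "convex_on UNIV \<phi>"
    and L: "\<And>y. y \<in> cball x 1 \<Longrightarrow> \<phi> y \<le> \<phi> x + L"
  shows "\<phi> (x + d) \<ge> \<phi> x - L * norm d"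
proof (cases "d = 0")
  case False
  define n where "n = norm d"
  have n: "n > 0" using False by (simp add: n_def)
  define u where "u = d /\<^sub>R n"
  have d: "d = n *\<^sub>R u" using n by (simp add: u_def)
  have nu: "norm u = 1" using n by (simp add: u_def n_def)
  have "x = (1 - 1/(1+n)) *\<^sub>R (x - u) + (1/(1+n)) *\<^sub>R (x + d)"
  proof -
    have "(1 - 1/(1+n)) *\<^sub>R (x - u) + (1/(1+n)) *\<^sub>R (x + n *\<^sub>R u)
      = x + ((1/(1+n)) * n - (1 - 1/(1+n))) *\<^sub>R u"
      by (simp add: algebra_simps)
    moreover have "(1/(1+n)) * n - (1 - 1/(1+n)) = 0" using n by (simp add: field_simps)
    ultimately show ?thesis unfolding d by simp
  qed
  then have "\<phi> x \<le> (1 - 1/(1+n)) * \<phi> (x - u) + (1/(1+n)) * \<phi> (x + d)"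
    using convex_onD[OF convex, of "1/(1+n)" "x - u" "x + d"] n by simp
  then have "(1+n) * \<phi> x \<le> (1+n) * ((1 - 1/(1+n)) * \<phi> (x - u) + (1/(1+n)) * \<phi> (x + d))"
    using n by (intro mult_left_mono) auto
  also have "\<dots> = n * \<phi> (x - u) + \<phi> (x + d)"
  proof -
    have "(1+n) * (1 - 1/(1+n)) = n" "(1+n) * (1/(1+n)) = 1" using n by (auto simp: field_simps)
    then show ?thesis by (simp only: distrib_left mult.assoc[symmetric] mult_1)
  qed
  finally have "(1+n) * \<phi> x \<le> n * \<phi> (x - u) + \<phi> (x + d)" .
  moreover have "\<phi> (x - u) \<le> \<phi> x + L" using nu by (intro L) (simp add: dist_norm)
  then have "n * \<phi> (x - u) \<le> n * (\<phi> x + L)" using n by simp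
  ultimately show ?thesis by (simp add: n_def algebra_simps)
qed simp

lemma convex_on_UNIV_bounded_above_near:
  fixes \<phi> :: "'a::euclidean_space \<Rightarrow> real"
  assumes convex: "convex_on UNIV \<phi>"
  obtains L where "L \<ge> 0" "\<And>x y. dist x z \<le> 1 \<Longrightarrow> y \<in> cball x 1 \<Longrightarrow> \<phi> y \<le> \<phi> x + L"
proof -
  have "continuous_on (cball z 2) \<phi>"
    using convex_on_continuous[OF open_UNIV convex] continuous_on_subset by blast
  then have "bounded (\<phi> ` cball z 2)"
    by (intro compact_imp_bounded compact_continuous_image compact_cball)
  then obtain K where K: "\<And>y. y \<in> cball z 2 \<Longrightarrow> \<bar>\<phi> y\<bar> \<le> K"
    unfolding bounded_iff by (metis imageI real_norm_def)
  show ?thesis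
  proof (rule that[of "2 * K"])
    show "2 * K \<ge> 0" using K[of z] by simp
    fix x y assume xy: "dist x z \<le> 1" "y \<in> cball x 1"
    have "dist y z \<le> dist y x + dist x z" by (rule dist_triangle)
    then have "y \<in> cball z 2" "x \<in> cball z 2" using xy by (auto simp: dist_commute)
    with K[of x] K[of y] show "\<phi> y \<le> \<phi> x + 2 * K" by linarith
  qed
qed

lemma composite_model_lower_bound:
  assumes convex: "convex_on UNIV \<phi>"
    and L: "\<And>y. y \<in> cball x 1 \<Longrightarrow> \<phi> y \<le> \<phi> x + L"
    and A: "d \<bullet> A d \<ge> m * (norm d)\<^sup>2"
  shows "composite_model \<phi> x g A d \<ge> \<phi> x + norm d * (m / 2 * norm d - (norm g + L))"
proof -
  have "\<phi> (x + d) \<ge> \<phi> x - L * norm d"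
    by (rule convex_on_UNIV_linear_lower_bound[OF convex L])
  moreover have "g \<bullet> d \<ge> - (norm g * norm d)"
    using Cauchy_Schwarz_ineq2[of g d] by linarith
  ultimately show ?thesis using A
    by (simp add: composite_model_def power2_eq_square algebra_simps)
qed

text \<open>
  The quadratic growth beats the linear lower bound of \<open>\<phi>\<close>, so outside a ball of radius \<open>R\<close> the
  model is at least its value at \<open>0\<close>; a minimizer on the compact ball is therefore global.
\<close>

lemma composite_model_minimizer_exists:
  fixes \<phi> :: "'a::euclidean_space \<Rightarrow> real"
  assumes convex: "convex_on UNIV \<phi>" and lin: "linear A"
    and m: "m > 0" and A: "\<And>d. d \<bullet> A d \<ge> m * (norm d)\<^sup>2"
  shows "\<exists>d. is_arg_min (composite_model \<phi> x g A) (\<lambda>_. True) d"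
proof -
  obtain L where L: "L \<ge> 0" "\<And>y. y \<in> cball x 1 \<Longrightarrow> \<phi> y \<le> \<phi> x + L"
    using convex_on_UNIV_bounded_above_near[OF convex, of x] by (metis dist_self zero_le_one)
  define R where "R = 2 * (norm g + L) / m"
  let ?h = "composite_model \<phi> x g A"
  have R: "R \<ge> 0" using m L by (simp add: R_def)
  have "continuous_on UNIV \<phi>" using convex_on_continuous[OF open_UNIV convex] .
  then have "continuous_on UNIV (\<lambda>d. \<phi> (x + d))"
    by (rule continuous_on_compose2) (auto intro: continuous_intros)
  moreover have "continuous_on UNIV A"
    using lin by (simp add: linear_continuous_on linear_conv_bounded_linear)
  ultimately have "continuous_on UNIV ?h"
    unfolding composite_model_def by (intro continuous_intros)
  then have "continuous_on (cball 0 R) ?h" using continuous_on_subset by blast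
  then obtain d where d: "\<And>y. y \<in> cball 0 R \<Longrightarrow> ?h d \<le> ?h y"
    using continuous_attains_inf[of "cball 0 R" ?h] R by (metis cball_eq_empty compact_cball not_le)
  have "?h d \<le> ?h y" for y
  proof (cases "norm y \<le> R")
    case False
    have "m / 2 * norm y \<ge> m / 2 * R" using False m by simp
    also have "m / 2 * R = norm g + L" using m by (simp add: R_def)
    finally have "0 \<le> norm y * (m / 2 * norm y - (norm g + L))" by simp
    moreover have "\<phi> x + norm y * (m / 2 * norm y - (norm g + L)) \<le> ?h y"
      by (intro composite_model_lower_bound convex L(2) A)
    ultimately have "?h y \<ge> \<phi> x" by linarith
    moreover have "?h 0 = \<phi> x" by (simp add: composite_model_def)
    ultimately show ?thesis using d[of 0] R by simp
  qed (use d in auto)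
  then show ?thesis by (auto simp: is_arg_min_def not_less)
qed

text \<open>
  Compare the minimizer with the points \<open>d + t w\<close> of the segment towards \<open>y - x\<close>: convexity turns
  the difference of the \<open>\<phi>\<close>-values into a linear term in \<open>t\<close>. Dividing by \<open>t\<close> and letting
  \<open>t \<rightarrow> 0\<close> removes the quadratic term.
\<close>

lemma composite_model_first_order:
  fixes \<phi> :: "'a::real_inner \<Rightarrow> real"
  assumes convex: "convex_on UNIV \<phi>" and lin: "linear A"
    and sym: "\<And>u v. u \<bullet> A v = A u \<bullet> v"
    and min: "is_arg_min (composite_model \<phi> x g A) (\<lambda>_. True) d"
  shows "\<phi> y - \<phi> (x + d) + (g + A d) \<bullet> (y - (x + d)) \<ge> 0"
proof -
  define w where "w = y - (x + d)"
  define D where "D = \<phi> y - \<phi> (x + d) + (g + A d) \<bullet> w"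
  have key: "D + t * (1/2 * (w \<bullet> A w)) \<ge> 0" if t: "0 < t" "t < 1" for t
  proof -
    have "composite_model \<phi> x g A d \<le> composite_model \<phi> x g A (d + t *\<^sub>R w)"
      using min by (simp add: is_arg_min_def not_less)
    moreover have "\<phi> (x + (d + t *\<^sub>R w)) \<le> (1 - t) * \<phi> (x + d) + t * \<phi> y"
      using convex_onD[OF convex, of t "x + d" y] t by (simp add: w_def algebra_simps)
    moreover have "(d + t *\<^sub>R w) \<bullet> A (d + t *\<^sub>R w)
        = d \<bullet> A d + 2 * t * (A d \<bullet> w) + t * t * (w \<bullet> A w)"
      using sym[of d w] inner_commute[of w "A d"]
      by (simp add: linear_add[OF lin] linear_scale[OF lin] inner_add_left inner_add_right algebra_simps)
    ultimately have "0 \<le> t * (D + t * (1/2 * (w \<bullet> A w)))"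
      unfolding composite_model_def D_def
      by (simp add: inner_add_left inner_add_right algebra_simps)
    then show ?thesis using t by (simp add: zero_le_mult_iff)
  qed
  have "((\<lambda>t. D + t * (1/2 * (w \<bullet> A w))) \<longlongrightarrow> D + 0 * (1/2 * (w \<bullet> A w))) (at_right 0)"
    by (intro tendsto_intros)
  moreover have "eventually (\<lambda>t. D + t * (1/2 * (w \<bullet> A w)) \<ge> 0) (at_right 0)"
    by (rule eventually_mono[OF eventually_at_right_real[of 0 1]]) (use key in auto)
  ultimately have "0 \<le> D + 0 * (1/2 * (w \<bullet> A w))"
    by (rule tendsto_lowerbound) simp
  then show ?thesis by (simp add: D_def w_def)
qed

text \<open>
  Test the first-order condition of each minimizer with the point reached by the other one and add:
  the values of \<open>\<phi>\<close> cancel.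
\<close>

lemma composite_model_minimizers_monotone:
  fixes \<phi> :: "'a::real_inner \<Rightarrow> real"
  assumes convex: "convex_on UNIV \<phi>"
    and "linear A" "\<And>u v. u \<bullet> A v = A u \<bullet> v"
    and "linear A'" "\<And>u v. u \<bullet> A' v = A' u \<bullet> v"
    and "is_arg_min (composite_model \<phi> x g A) (\<lambda>_. True) d"
    and "is_arg_min (composite_model \<phi> x' g' A') (\<lambda>_. True) d'"
  shows "((g + A d) - (g' + A' d')) \<bullet> ((x' + d') - (x + d)) \<ge> 0"
proof -
  have "\<phi> (x' + d') - \<phi> (x + d) + (g + A d) \<bullet> ((x' + d') - (x + d)) \<ge> 0"
    using assms by (intro composite_model_first_order)
  moreover have "\<phi> (x + d) - \<phi> (x' + d') + (g' + A' d') \<bullet> ((x + d) - (x' + d')) \<ge> 0"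
    using assms by (intro composite_model_first_order)
  ultimately show ?thesis
    by (simp add: inner_diff_left inner_diff_right inner_add_left inner_add_right algebra_simps)
qed


section \<open>The residual\<close>

lemma residual_is_arg_min:
  fixes \<phi> :: "real^'n \<Rightarrow> real"
  assumes "convex_on UNIV \<phi>"
  shows "is_arg_min (composite_model \<phi> x (f' x) (\<lambda>d. d)) (\<lambda>_. True) (residual f' \<phi> x)"
proof -
  have eq: "(\<lambda>d. f' x \<bullet> d + 1/2 * (d \<bullet> (mat 1 *v d)) + \<phi> (x + d)) = composite_model \<phi> x (f' x) (\<lambda>d. d)"
    by (simp add: composite_model_def fun_eq_iff)
  have "\<exists>d. is_arg_min (composite_model \<phi> x (f' x) (\<lambda>d. d)) (\<lambda>_. True) d"
    using assms by (rule composite_model_minimizer_exists[where m = 1])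
      (auto simp: power2_norm_eq_inner intro: linear_ident)
  then show ?thesis
    unfolding residual_def prox_residual_def eq arg_min_def by (rule someI_ex)
qed

text \<open>
  With \<open>w = (y + r(y)) - (x + r(x))\<close>, monotonicity reads
  \<open>w \<bullet> w \<le> ((f'(x) - f'(y)) - (x - y)) \<bullet> w\<close>, which bounds \<open>\<parallel>w\<parallel>\<close>.
\<close>

lemma residual_diff_le:
  fixes \<phi> :: "real^'n \<Rightarrow> real"
  assumes "convex_on UNIV \<phi>"
  shows "norm (residual f' \<phi> x - residual f' \<phi> y) \<le> norm (f' x - f' y) + 2 * norm (x - y)"
proof -
  define rx ry where "rx = residual f' \<phi> x" and "ry = residual f' \<phi> y"
  define w where "w = (y + ry) - (x + rx)"
  have "((f' x + rx) - (f' y + ry)) \<bullet> w \<ge> 0"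
    unfolding w_def rx_def ry_def
    by (rule composite_model_minimizers_monotone[OF assms linear_ident _ linear_ident _
          residual_is_arg_min[OF assms] residual_is_arg_min[OF assms]]) simp_all
  moreover have "(f' x + rx) - (f' y + ry) = ((f' x - f' y) - (x - y)) - w"
    by (simp add: w_def)
  ultimately have "w \<bullet> w \<le> ((f' x - f' y) - (x - y)) \<bullet> w"
    by (simp add: inner_diff_left)
  also have "\<dots> \<le> norm ((f' x - f' y) - (x - y)) * norm w" by (rule norm_cauchy_schwarz)
  finally have "norm w * norm w \<le> norm ((f' x - f' y) - (x - y)) * norm w"
    by (simp add: power2_norm_eq_inner[symmetric] power2_eq_square)
  then have "norm w \<le> norm ((f' x - f' y) - (x - y))"
    by (cases "w = 0") auto
  also have "\<dots> \<le> norm (f' x - f' y) + norm (x - y)" by (rule norm_triangle_ineq4)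
  finally have w: "norm w \<le> norm (f' x - f' y) + norm (x - y)" .
  have "norm (rx - ry) = norm (w + (x - y))"
    by (simp add: w_def norm_minus_commute)
  also have "\<dots> \<le> norm w + norm (x - y)" by (rule norm_triangle_ineq)
  finally show ?thesis using w unfolding rx_def ry_def by linarith
qed

lemma stationary_point_if_residual_zero:
  fixes \<phi> :: "real^'n \<Rightarrow> real"
  assumes "convex_on UNIV \<phi>" and zero: "residual f' \<phi> x = 0"
  shows "stationary_point f' \<phi> x"
proof -
  have "\<phi> y - \<phi> x + f' x \<bullet> (y - x) \<ge> 0" for y
    using composite_model_first_order[OF assms(1) linear_ident _
          residual_is_arg_min[OF assms(1), of x f'], of y] zero by simp
  then have "- f' x \<in> subdifferential \<phi> x"
    by (simp add: subdifferential_def algebra_simps)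
  then show ?thesis unfolding stationary_point_def by force
qed


section \<open>The regularized subproblem\<close>

abbreviation reg_hessian :: "real^'n^'n \<Rightarrow> real \<Rightarrow> real^'n \<Rightarrow> real^'n" where
  "reg_hessian B \<mu> d \<equiv> B *v d + \<mu> *\<^sub>R d"

lemma solves_subproblem_iff:
  "solves_subproblem f f' \<phi> B \<mu> x d \<longleftrightarrow>
     is_arg_min (composite_model \<phi> x (f' x) (reg_hessian B \<mu>)) (\<lambda>_. True) d"
proof -
  have "reg_model f f' \<phi> B \<mu> x = (\<lambda>d. f x + composite_model \<phi> x (f' x) (reg_hessian B \<mu>) d)"
    by (simp add: fun_eq_iff reg_model_def model_def composite_model_def inner_add_right
        power2_norm_eq_inner algebra_simps)
  then show ?thesis by (simp add: solves_subproblem_def is_arg_min_def)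
qed

lemma linear_reg_hessian: "linear (reg_hessian B \<mu>)"
  by (rule linearI) (simp_all add: algebra_simps)

lemma reg_hessian_symmetric:
  assumes "transpose B = B"
  shows "u \<bullet> reg_hessian B \<mu> v = reg_hessian B \<mu> u \<bullet> v"
proof -
  have "u \<bullet> (B *v v) = (B *v u) \<bullet> v"
    using dot_lmul_matrix[of u B v] vector_transpose_matrix[of u B] assms
    by (metis dot_lmul_matrix vector_transpose_matrix)
  then show ?thesis by (simp add: inner_add_left inner_add_right)
qed

lemma abs_quadratic_form_le:
  fixes B :: "real^'n^'n"
  assumes "\<And>v. norm (B *v v) \<le> \<beta> * norm v"
  shows "\<bar>d \<bullet> (B *v d)\<bar> \<le> \<beta> * (norm d)\<^sup>2"
proof -
  have "\<bar>d \<bullet> (B *v d)\<bar> \<le> norm d * norm (B *v d)" by (rule Cauchy_Schwarz_ineq2)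
  also have "\<dots> \<le> norm d * (\<beta> * norm d)" using assms by (intro mult_left_mono) auto
  finally show ?thesis by (simp add: power2_eq_square algebra_simps)
qed

lemma reg_hessian_coercive:
  assumes "\<And>v. norm (B *v v) \<le> \<beta> * norm v"
  shows "d \<bullet> reg_hessian B \<mu> d \<ge> (\<mu> - \<beta>) * (norm d)\<^sup>2"
  using abs_quadratic_form_le[OF assms, of d]
  by (simp add: inner_add_right power2_norm_eq_inner algebra_simps)

text \<open>
  The monotonicity inequality for the residual and a subproblem solution at the same point \<open>x\<close>, with
  the terms in \<open>B\<close> estimated by its norm bound \<open>\<beta>\<close>. For \<open>\<mu> < \<beta>\<close> the subproblem may be nonconvex
  and the last term positive.
\<close>

lemma residual_square_le_direction:
  fixes \<phi> :: "real^'n \<Rightarrow> real"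
  assumes convex: "convex_on UNIV \<phi>" and sym: "transpose B = B"
    and \<beta>: "\<And>v. norm (B *v v) \<le> \<beta> * norm v" and "\<mu> \<ge> 0"
    and sol: "solves_subproblem f f' \<phi> B \<mu> x d"
  shows "(norm (residual f' \<phi> x))\<^sup>2
    \<le> norm (residual f' \<phi> x) * ((1 + \<beta> + \<mu>) * norm d) + (\<beta> - \<mu>) * (norm d)\<^sup>2"
proof -
  define r where "r = residual f' \<phi> x"
  let ?H = "reg_hessian B \<mu>"
  have "((f' x + r) - (f' x + ?H d)) \<bullet> ((x + d) - (x + r)) \<ge> 0"
    unfolding r_def
    by (rule composite_model_minimizers_monotone[OF convex linear_ident _ linear_reg_hessian
          reg_hessian_symmetric[OF sym] residual_is_arg_min[OF convex]
          sol[unfolded solves_subproblem_iff]]) simp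
  then have "r \<bullet> r \<le> r \<bullet> (d + ?H d) - d \<bullet> ?H d"
    by (simp add: algebra_simps inner_diff_left inner_diff_right inner_add_left inner_add_right inner_commute)
  moreover have "r \<bullet> (d + ?H d) \<le> norm r * ((1 + \<beta> + \<mu>) * norm d)"
  proof -
    have "norm (d + ?H d) \<le> norm d + (norm (B *v d) + norm (\<mu> *\<^sub>R d))"
      by (meson add_left_mono norm_triangle_ineq order_trans)
    also have "\<dots> \<le> (1 + \<beta> + \<mu>) * norm d" using \<beta>[of d] \<open>\<mu> \<ge> 0\<close> by (simp add: algebra_simps)
    finally show ?thesis
      by (meson mult_left_mono norm_cauchy_schwarz norm_ge_zero order_trans)
  qed
  moreover have "d \<bullet> ?H d \<ge> (\<mu> - \<beta>) * (norm d)\<^sup>2" by (rule reg_hessian_coercive[OF \<beta>])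
  ultimately show ?thesis
    unfolding r_def[symmetric] power2_norm_eq_inner[of r] by (simp add: algebra_simps)
qed

text \<open>
  This holds for every parameter \<open>\<mu> \<ge> 0\<close>, convex subproblem or not; the factor \<open>2\<close> absorbs
  the last term of the preceding quadratic inequality. It excludes short accepted
  steps while the residual is bounded away from zero and the parameters are bounded.
\<close>

lemma residual_le_direction:
  fixes \<phi> :: "real^'n \<Rightarrow> real"
  assumes convex: "convex_on UNIV \<phi>" and sym: "transpose B = B"
    and \<beta>: "\<And>v. norm (B *v v) \<le> \<beta> * norm v" and "\<mu> \<ge> 0" and "\<beta> \<ge> 0"
    and sol: "solves_subproblem f f' \<phi> B \<mu> x d"
  shows "norm (residual f' \<phi> x) \<le> 2 * (1 + \<beta> + \<mu>) * norm d"
proof (rule ccontr)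
  define R s where "R = norm (residual f' \<phi> x)" and "s = (1 + \<beta> + \<mu>) * norm d"
  assume "\<not> ?thesis"
  then have R: "R > 2 * s" by (simp add: R_def s_def algebra_simps)
  have s: "s \<ge> 0" using assms by (simp add: s_def)
  have "\<beta> - \<mu> \<le> (1 + \<beta> + \<mu>)\<^sup>2" using \<open>\<mu> \<ge> 0\<close> \<open>\<beta> \<ge> 0\<close>
    by (simp add: power2_eq_square algebra_simps add_increasing)
  then have "(\<beta> - \<mu>) * (norm d)\<^sup>2 \<le> s\<^sup>2"
    unfolding s_def power_mult_distrib by (intro mult_right_mono) auto
  then have "R\<^sup>2 \<le> R * s + s\<^sup>2"
    using residual_square_le_direction[OF convex sym \<beta> \<open>\<mu> \<ge> 0\<close> sol] unfolding R_def s_def by linarith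
  moreover have "R * R > 2 * s * R" using R s by (intro mult_strict_right_mono) auto
  moreover have "s * R \<ge> s * (2 * s)" using R s by (intro mult_left_mono) auto
  moreover have "s * s \<ge> 0" by simp
  ultimately show False unfolding power2_eq_square by (simp add: algebra_simps)
qed

text \<open>
  In the convex case the factor \<open>2\<close> disappears. Since
  \<open>p (1 + \<beta> + \<mu>) \<le> \<mu> - \<beta> / 2\<close> for \<open>p < 1/2\<close> and \<open>\<mu> \<ge> 1 + 2 \<beta>\<close>, the predicted-reduction test then
  holds from a threshold on that does not depend on how close \<open>p\<close> is to \<open>1/2\<close>.
\<close>

lemma residual_le_direction_convex_model:
  fixes \<phi> :: "real^'n \<Rightarrow> real"
  assumes convex: "convex_on UNIV \<phi>" and sym: "transpose B = B"
    and \<beta>: "\<And>v. norm (B *v v) \<le> \<beta> * norm v" and "\<mu> \<ge> \<beta>" and "\<beta> \<ge> 0"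
    and sol: "solves_subproblem f f' \<phi> B \<mu> x d"
  shows "norm (residual f' \<phi> x) \<le> (1 + \<beta> + \<mu>) * norm d"
proof -
  have "\<mu> \<ge> 0" using assms by simp
  have "(\<beta> - \<mu>) * (norm d)\<^sup>2 \<le> 0" using \<open>\<mu> \<ge> \<beta>\<close> by (simp add: mult_nonpos_nonneg)
  then have "norm (residual f' \<phi> x) * norm (residual f' \<phi> x)
      \<le> norm (residual f' \<phi> x) * ((1 + \<beta> + \<mu>) * norm d)"
    using residual_square_le_direction[OF convex sym \<beta> \<open>\<mu> \<ge> 0\<close> sol]
    unfolding power2_eq_square[of "norm (residual f' \<phi> x)"] by linarith
  then show ?thesis 
    using \<open>\<beta> \<ge> 0\<close> \<open>\<mu> \<ge> 0\<close> by (cases "residual f' \<phi> x = 0") auto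
qed

text \<open>
  The first-order condition of the direction, tested at \<open>x\<close> itself.
\<close>

lemma pred_red_lower_bound:
  fixes \<phi> :: "real^'n \<Rightarrow> real"
  assumes convex: "convex_on UNIV \<phi>" and sym: "transpose B = B"
    and \<beta>: "\<And>v. norm (B *v v) \<le> \<beta> * norm v"
    and sol: "solves_subproblem f f' \<phi> B \<mu> x d"
  shows "pred_red f f' \<phi> B x d \<ge> (\<mu> - \<beta> / 2) * (norm d)\<^sup>2"
proof -
  have "\<phi> x - \<phi> (x + d) + (f' x + reg_hessian B \<mu> d) \<bullet> (x - (x + d)) \<ge> 0"
    by (rule composite_model_first_order[OF convex linear_reg_hessian reg_hessian_symmetric[OF sym]
          sol[unfolded solves_subproblem_iff]])
  then have "\<phi> x - \<phi> (x + d) \<ge> f' x \<bullet> d + d \<bullet> (B *v d) + \<mu> * (norm d)\<^sup>2"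
    by (simp add: inner_add_left inner_add_right power2_norm_eq_inner inner_commute)
  then show ?thesis
    using abs_quadratic_form_le[OF \<beta>, of d]
    by (simp add: pred_red_def model_def algebra_simps)
qed

lemma gradient_mean_value:
  fixes f :: "'a::real_inner \<Rightarrow> real"
  assumes "\<And>y. GDERIV f y :> f' y"
  obtains z where "dist z x \<le> norm d" "f (x + d) - f x = f' z \<bullet> d"
proof -
  let ?p = "\<lambda>t::real. x + t *\<^sub>R d"
  have "((\<lambda>t. f (?p t)) has_derivative (\<lambda>h. f' (?p t) \<bullet> (h *\<^sub>R d))) (at t within {0..1})" for t
  proof -
    have "(?p has_derivative (\<lambda>h. h *\<^sub>R d)) (at t within {0..1})"
      by (auto intro!: derivative_eq_intros)
    moreover have "(f has_derivative (\<lambda>h. f' (?p t) \<bullet> h)) (at (?p t))"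
      using assms[of "?p t"] by (simp add: gderiv_def inner_commute)
    ultimately show ?thesis by (rule has_derivative_compose)
  qed
  then obtain t where "t \<in> {0<..<1}" "f (?p 1) - f (?p 0) = f' (?p t) \<bullet> ((1 - 0) *\<^sub>R d)"
    using mvt_simple[of 0 1 "\<lambda>t. f (?p t)" "\<lambda>t h. f' (?p t) \<bullet> (h *\<^sub>R d)"] by auto
  then show ?thesis
    by (intro that[of "?p t"]) (auto simp: dist_norm mult_left_le_one_le)
qed

lemma regularized_subproblem_solvable:
  assumes convex: "convex_on UNIV \<phi>"
    and \<beta>: "\<And>v. norm (B *v v) \<le> \<beta> * norm v" and "\<mu> > \<beta>"
  shows "\<exists>d. solves_subproblem f f' \<phi> B \<mu> x d"
  unfolding solves_subproblem_iff
proof (rule composite_model_minimizer_exists[OF convex linear_reg_hessian])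
  show "\<mu> - \<beta> > 0" using assms by simp
  show "d \<bullet> reg_hessian B \<mu> d \<ge> (\<mu> - \<beta>) * (norm d)\<^sup>2" for d
    by (rule reg_hessian_coercive[OF \<beta>])
qed

text \<open>
  The model does not exceed its value at \<open>0\<close>, while it grows at least like a quadratic with leading
  coefficient \<open>(\<mu> - \<beta>) / 2\<close>. Hence directions are short for large \<open>\<mu>\<close>, uniformly for \<open>x\<close> near a
  given point.
\<close>

lemma direction_le_of_large_regularization:
  assumes convex: "convex_on UNIV \<phi>"
    and \<beta>: "\<And>v. norm (B *v v) \<le> \<beta> * norm v"
    and L: "L \<ge> 0" "\<And>y. y \<in> cball x 1 \<Longrightarrow> \<phi> y \<le> \<phi> x + L"
    and sol: "solves_subproblem f f' \<phi> B \<mu> x d"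
  shows "(\<mu> - \<beta>) * norm d \<le> 2 * (norm (f' x) + L)"
proof (cases "d = 0")
  case False
  let ?h = "composite_model \<phi> x (f' x) (reg_hessian B \<mu>)"
  have "d \<bullet> reg_hessian B \<mu> d \<ge> (\<mu> - \<beta>) * (norm d)\<^sup>2" by (rule reg_hessian_coercive[OF \<beta>])
  then have "\<phi> x + norm d * ((\<mu> - \<beta>) / 2 * norm d - (norm (f' x) + L)) \<le> ?h d"
    by (intro composite_model_lower_bound convex L(2))
  also have "?h d \<le> ?h 0"
    using sol by (simp add: solves_subproblem_iff is_arg_min_def not_less)
  also have "?h 0 = \<phi> x" by (simp add: composite_model_def)
  finally have "norm d * ((\<mu> - \<beta>) / 2 * norm d - (norm (f' x) + L)) \<le> 0" by simp
  then have "(\<mu> - \<beta>) / 2 * norm d - (norm (f' x) + L) \<le> 0"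
    using False by (simp add: mult_le_0_iff)
  then show ?thesis by simp
qed (use L in simp)

text \<open>
  The two reductions differ by the linearization error of \<open>f\<close>, which is controlled through the mean
  value theorem, and by the quadratic term of the model.
\<close>

lemma actual_red_lower_bound:
  fixes f :: "real^'n \<Rightarrow> real"
  assumes gradient: "\<And>y. GDERIV f y :> f' y"
    and \<beta>: "\<And>v. norm (B *v v) \<le> \<beta> * norm v"
    and \<eta>: "\<And>z. dist z x \<le> norm d \<Longrightarrow> norm (f' x - f' z) \<le> \<eta>"
  shows "actual_red f \<phi> x d \<ge> pred_red f f' \<phi> B x d - (\<eta> + \<beta> / 2 * norm d) * norm d"
proof -
  obtain z where z: "dist z x \<le> norm d" "f (x + d) - f x = f' z \<bullet> d"
    using gradient_mean_value[OF gradient] .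
  have "(f' x - f' z) \<bullet> d \<ge> - (norm (f' x - f' z) * norm d)"
    using Cauchy_Schwarz_ineq2[of "f' x - f' z" d] by linarith
  moreover have "norm (f' x - f' z) * norm d \<le> \<eta> * norm d"
    using \<eta>[OF z(1)] by (intro mult_right_mono) auto
  moreover have "1/2 * (d \<bullet> (B *v d)) \<ge> - (\<beta> / 2 * (norm d)\<^sup>2)"
    using abs_quadratic_form_le[OF \<beta>, of d] by linarith
  ultimately show ?thesis using z(2)
    by (simp add: actual_red_def pred_red_def model_def inner_diff_left power2_eq_square algebra_simps)
qed

text \<open>
  The ratio test is stated without division, which is equivalent once the predicted reduction is
  positive.
\<close>

definition accepted ::
  "(real^'n \<Rightarrow> real) \<Rightarrow> (real^'n \<Rightarrow> real^'n) \<Rightarrow> (real^'n \<Rightarrow> real) \<Rightarrow> real \<Rightarrow> real \<Rightarrow>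
   real^'n^'n \<Rightarrow> real^'n \<Rightarrow> real^'n \<Rightarrow> real \<Rightarrow> bool" where
  "accepted f f' \<phi> p c B d x \<mu> \<longleftrightarrow> solves_subproblem f f' \<phi> B \<mu> x d \<and>
     pred_red f f' \<phi> B x d > p * norm d * norm (residual f' \<phi> x) \<and>
     actual_red f \<phi> x d > c * pred_red f f' \<phi> B x d"

text \<open>
  Large regularization makes the direction short, uniformly near \<open>z\<close>. The predicted reduction is
  then greater than \<open>p \<parallel>d\<parallel> \<parallel>r(x)\<parallel>\<close>, hence than \<open>p \<epsilon> \<parallel>d\<parallel>\<close>. The actual reduction
  falls short of it by at most a small multiple of \<open>\<parallel>d\<parallel>\<close> because \<open>f'\<close> is continuous at \<open>z\<close>.
  The choice of \<open>\<eta>\<close> and \<open>\<tau>\<close> makes this error at most \<open>p \<epsilon> \<parallel>d\<parallel> / 2\<close>, half the lower bound for the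
  predicted reduction, so the ratio exceeds \<open>1/2 > c\<close>.
\<close>

lemma accepted_near_point:
  fixes f \<phi> :: "real^'n \<Rightarrow> real"
  assumes gradient: "\<And>y. GDERIV f y :> f' y"
    and C1: "continuous_on UNIV f'"
    and convex: "convex_on UNIV \<phi>"
    and p: "0 < p" "p < 1/2" and c: "c < 1/2"
    and "\<beta> \<ge> 0" and \<epsilon>: "\<epsilon> > 0"
  shows "\<exists>\<delta>>0. \<exists>M>\<beta>. \<forall>B \<mu> x d. transpose B = B \<longrightarrow> (\<forall>v. norm (B *v v) \<le> \<beta> * norm v) \<longrightarrow>
     dist x z < \<delta> \<longrightarrow> norm (residual f' \<phi> x) \<ge> \<epsilon> \<longrightarrow> \<mu> \<ge> M \<longrightarrow> solves_subproblem f f' \<phi> B \<mu> x d \<longrightarrow>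
     accepted f f' \<phi> p c B d x \<mu>"
proof -
  define \<eta> where "\<eta> = p * \<epsilon> / 8"
  have \<eta>: "\<eta> > 0" using p \<epsilon> by (simp add: \<eta>_def)
  then obtain \<delta>\<^sub>0 where \<delta>\<^sub>0: "\<delta>\<^sub>0 > 0" "\<And>y. dist y z < \<delta>\<^sub>0 \<Longrightarrow> dist (f' y) (f' z) < \<eta>"
    using C1 unfolding continuous_on_iff by (metis UNIV_I)
  obtain L where L: "L \<ge> 0" "\<And>x y. dist x z \<le> 1 \<Longrightarrow> y \<in> cball x 1 \<Longrightarrow> \<phi> y \<le> \<phi> x + L"
    using convex_on_UNIV_bounded_above_near[OF convex] by blast
  define \<tau> where "\<tau> = min (\<delta>\<^sub>0 / 2) (p * \<epsilon> / (2 * (\<beta> + 1)))"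
  define G where "G = norm (f' z) + \<eta>"
  define M where "M = 1 + 2 * \<beta> + 2 * (G + L) / \<tau>"
  define \<delta> where "\<delta> = min 1 (\<delta>\<^sub>0 / 2)"
  have \<tau>: "\<tau> > 0" using \<delta>\<^sub>0 p \<epsilon> \<open>\<beta> \<ge> 0\<close> by (simp add: \<tau>_def)
  have GL: "G + L \<ge> 0" using \<eta> L by (simp add: G_def)
  have M: "M \<ge> 1 + 2 * \<beta>" using GL \<tau> by (simp add: M_def)
  have "\<delta> > 0" using \<delta>\<^sub>0 by (simp add: \<delta>_def)
  moreover have "M > \<beta>" using M \<open>\<beta> \<ge> 0\<close> by linarith
  moreover have "\<forall>B \<mu> x d. transpose B = B \<longrightarrow> (\<forall>v. norm (B *v v) \<le> \<beta> * norm v) \<longrightarrow>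
     dist x z < \<delta> \<longrightarrow> norm (residual f' \<phi> x) \<ge> \<epsilon> \<longrightarrow> \<mu> \<ge> M \<longrightarrow> solves_subproblem f f' \<phi> B \<mu> x d \<longrightarrow>
     accepted f f' \<phi> p c B d x \<mu>"
  proof (intro allI impI)
    fix B \<mu> x d
    assume sym: "transpose B = B" and "\<forall>v. norm (B *v v) \<le> \<beta> * norm v"
      and x: "dist x z < \<delta>" and r: "norm (residual f' \<phi> x) \<ge> \<epsilon>" and \<mu>: "\<mu> \<ge> M"
      and sol: "solves_subproblem f f' \<phi> B \<mu> x d"
    then have \<beta>: "norm (B *v v) \<le> \<beta> * norm v" for v by blast
    let ?r = "norm (residual f' \<phi> x)" and ?pred = "pred_red f f' \<phi> B x d"
    have \<mu>': "\<mu> \<ge> 1 + 2 * \<beta>" "\<mu> \<ge> \<beta>" using \<mu> M \<open>\<beta> \<ge> 0\<close> by linarith+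
    have r_le: "?r \<le> (1 + \<beta> + \<mu>) * norm d"
      using residual_le_direction_convex_model[OF convex sym \<beta> \<mu>'(2) \<open>\<beta> \<ge> 0\<close> sol] .
    then have d: "norm d > 0" using r \<epsilon> by (cases "d = 0") auto

    have "0 < norm d * ?r" using d r \<epsilon> by (intro mult_pos_pos) linarith+
    then have "p * norm d * ?r < 1/2 * (norm d * ?r)"
      unfolding mult.assoc using p by (intro mult_strict_right_mono) auto
    also have "\<dots> \<le> 1/2 * (norm d * ((1 + \<beta> + \<mu>) * norm d))"
      using r_le by (intro mult_left_mono) auto
    also have "\<dots> = (1 + \<beta> + \<mu>) / 2 * (norm d)\<^sup>2" by (simp add: power2_eq_square)
    also have "\<dots> \<le> (\<mu> - \<beta> / 2) * (norm d)\<^sup>2" using \<mu>' by (intro mult_right_mono) auto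
    also have "\<dots> \<le> ?pred" by (rule pred_red_lower_bound[OF convex sym \<beta> sol])
    finally have pred: "?pred > p * norm d * ?r" .

    have fx: "dist (f' x) (f' z) < \<eta>" using x \<delta>\<^sub>0 by (auto simp: \<delta>_def)
    then have "norm (f' x) \<le> G"
      using norm_triangle_ineq2[of "f' x" "f' z"] by (simp add: G_def dist_norm)
    then have fL: "2 * (norm (f' x) + L) \<le> 2 * (G + L)" by simp
    have "(\<mu> - \<beta>) * norm d \<le> 2 * (norm (f' x) + L)"
      by (rule direction_le_of_large_regularization[OF convex \<beta> L(1) L(2) sol])
        (use x in \<open>auto simp: \<delta>_def\<close>)
    also have "\<dots> \<le> 2 * (G + L)" by (rule fL)
    also have "\<dots> = 2 * (G + L) / \<tau> * \<tau>" using \<tau> by simp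
    also have "\<dots> \<le> (\<mu> - \<beta>) * \<tau>"
      using \<mu> \<tau> \<open>\<beta> \<ge> 0\<close> by (intro mult_right_mono) (auto simp: M_def)
    finally have d_le: "norm d \<le> \<tau>"
      using \<mu>' \<open>\<beta> \<ge> 0\<close> by (simp add: mult_le_cancel_left)

    \<comment> \<open>\<open>x\<close> is within \<open>\<delta>\<^sub>0 / 2\<close> of \<open>z\<close> and \<open>\<parallel>d\<parallel> \<le> \<delta>\<^sub>0 / 2\<close>, so the whole step stays where \<open>f'\<close> is
      \<open>\<eta>\<close>-close to \<open>f' z\<close>.\<close>
    have "norm (f' x - f' y) \<le> p * \<epsilon> / 4" if "dist y x \<le> norm d" for y
    proof -
      have "dist y z < \<delta>\<^sub>0"
        using dist_triangle[of y z x] that d_le x by (simp add: \<tau>_def \<delta>_def)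
      then have "dist (f' x) (f' y) < \<eta> + \<eta>"
        using fx \<delta>\<^sub>0(2) by (metis add_strict_mono dist_triangle2 le_less_trans)
      then show ?thesis by (simp add: dist_norm \<eta>_def mult.commute)
    qed
    then have "actual_red f \<phi> x d \<ge> ?pred - (p * \<epsilon> / 4 + \<beta> / 2 * norm d) * norm d"
      by (rule actual_red_lower_bound[OF gradient \<beta>])
    moreover have "\<beta> * norm d \<le> p * \<epsilon> / 2"
    proof -
      have "\<beta> * norm d \<le> (\<beta> + 1) * (p * \<epsilon> / (2 * (\<beta> + 1)))"
        using d_le \<open>\<beta> \<ge> 0\<close> by (intro mult_mono) (auto simp: \<tau>_def)
      also have "\<dots> = p * \<epsilon> / 2" using \<open>\<beta> \<ge> 0\<close> by (simp add: field_simps)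
      finally show ?thesis .
    qed
    then have "(p * \<epsilon> / 4 + \<beta> / 2 * norm d) * norm d \<le> (p * \<epsilon> / 2) * norm d"
      by (intro mult_right_mono) (linarith, simp)
    moreover have "p * norm d * \<epsilon> \<le> p * norm d * ?r" using p r by (intro mult_left_mono) auto
    moreover have "c * ?pred \<le> 1/2 * ?pred"
    proof (rule mult_right_mono)
      have "0 \<le> p * norm d * ?r" using p by simp
      then show "0 \<le> ?pred" using pred by linarith
    qed (use c in simp)
    ultimately have "actual_red f \<phi> x d > c * ?pred" using pred by (simp add: algebra_simps)
    with pred sol show "accepted f f' \<phi> p c B d x \<mu>" by (simp add: accepted_def)
  qed
  ultimately show ?thesis by blast
qed


section \<open>Sequences with a residual-weighted descent property\<close>

text \<open>
  Here \<open>V\<close> stands for the objective values and \<open>R\<close> for the residuals. While the residual is at least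
  \<open>e\<close>, the distance travelled is paid for by the decrease of \<open>V\<close>, which telescopes.
\<close>

lemma residual_weighted_path_length:
  fixes V R :: "nat \<Rightarrow> real" and x :: "nat \<Rightarrow> 'a::metric_space"
  assumes descent: "\<And>k. V k - V (Suc k) \<ge> c * R k * dist (x (Suc k)) (x k)" and "c \<ge> 0"
    and "k \<le> l" and R: "\<And>j. k \<le> j \<Longrightarrow> j < l \<Longrightarrow> R j \<ge> e"
    and "e \<ge> 0"
  shows "c * e * dist (x l) (x k) \<le> V k - V l"
  using \<open>k \<le> l\<close> R
proof (induction l rule: dec_induct)
  case (step l)
  have "c * e * dist (x (Suc l)) (x k) \<le> c * e * (dist (x (Suc l)) (x l) + dist (x l) (x k))"
    using \<open>c \<ge> 0\<close> \<open>e \<ge> 0\<close> by (intro mult_left_mono dist_triangle) auto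
  also have "c * e * dist (x (Suc l)) (x l) \<le> c * R l * dist (x (Suc l)) (x l)"
    using \<open>c \<ge> 0\<close> step by (intro mult_right_mono mult_left_mono) auto
  then have "c * e * (dist (x (Suc l)) (x l) + dist (x l) (x k)) \<le> (V l - V (Suc l)) + (V k - V l)"
    using descent[of l] step by (simp add: distrib_left)
  finally show ?case by simp
qed simp

lemma descent_values_Cauchy:
  fixes V :: "nat \<Rightarrow> real"
  assumes "decseq V" "bdd_below (range V)" "e > 0"
  obtains N where "\<And>k l. N \<le> k \<Longrightarrow> N \<le> l \<Longrightarrow> V k - V l < e"
proof -
  have "convergent V"
    using assms by (metis LIMSEQ_decseq_INF convergentI)
  then have "Cauchy V" by (rule convergent_Cauchy)
  then obtain N where "\<forall>k\<ge>N. \<forall>l\<ge>N. dist (V k) (V l) < e"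
    using \<open>e > 0\<close> unfolding Cauchy_def by blast
  then show ?thesis by (intro that[of N]) (fastforce simp: dist_real_def)
qed

lemma Cauchy_if_residual_bounded_away:
  fixes V R :: "nat \<Rightarrow> real" and x :: "nat \<Rightarrow> 'a::metric_space"
  assumes descent: "\<And>k. V k - V (Suc k) \<ge> c * R k * dist (x (Suc k)) (x k)" and "c > 0"
    and V: "decseq V" "bdd_below (range V)"
    and "e > 0" and R: "\<And>j. j \<ge> K \<Longrightarrow> R j \<ge> e"
  shows "Cauchy x"
proof (rule metric_CauchyI)
  fix t :: real assume "t > 0"
  then have "c * e * t > 0" using \<open>c > 0\<close> \<open>e > 0\<close> by simp
  then obtain N where N: "\<And>k l. N \<le> k \<Longrightarrow> N \<le> l \<Longrightarrow> V k - V l < c * e * t"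
    using descent_values_Cauchy[OF V] by blast
  have close: "dist (x l) (x k) < t" if "max N K \<le> k" "k \<le> l" for k l
  proof -
    have "c * e * dist (x l) (x k) \<le> V k - V l"
      using residual_weighted_path_length[where V = V and R = R and x = x, OF descent _ \<open>k \<le> l\<close>, of e] \<open>c > 0\<close> \<open>e > 0\<close> R that by auto
    also have "\<dots> < c * e * t" using N that by simp
    finally show ?thesis using \<open>c > 0\<close> \<open>e > 0\<close> by simp
  qed
  have "dist (x k) (x l) < t" if "max N K \<le> k" "max N K \<le> l" for k l
    using close[of k l] close[of l k] that by (metis dist_commute nat_le_linear)
  then show "\<exists>M. \<forall>m\<ge>M. \<forall>n\<ge>M. dist (x m) (x n) < t" by blast
qed

text \<open>
  If \<open>R k \<ge> e\<close>, take the first later index \<open>l\<close> with \<open>R l < e / 2\<close>. The residual is at least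
  \<open>e / 2\<close> in between, so for late \<open>k\<close> the points \<open>x k\<close> and \<open>x l\<close> are close together although their
  residuals differ by more than \<open>e / 2\<close>.
\<close>

lemma residual_tendsto_zero:
  fixes V R :: "nat \<Rightarrow> real" and x :: "nat \<Rightarrow> 'a::metric_space"
  assumes descent: "\<And>k. V k - V (Suc k) \<ge> c * R k * dist (x (Suc k)) (x k)" and "c > 0"
    and V: "decseq V" "bdd_below (range V)"
    and R: "\<And>k. R k \<ge> 0"
    and small: "\<And>e K. e > 0 \<Longrightarrow> \<exists>k\<ge>K. R k < e"
    and uc: "\<And>e. e > 0 \<Longrightarrow> \<exists>t>0. \<forall>i j. dist (x i) (x j) < t \<longrightarrow> \<bar>R i - R j\<bar> < e"
  shows "R \<longlonglongrightarrow> 0"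
proof (rule LIMSEQ_I)
  fix e :: real assume "e > 0"
  then obtain t where t: "t > 0" "\<And>i j. dist (x i) (x j) < t \<Longrightarrow> \<bar>R i - R j\<bar> < e / 2"
    using uc[of "e / 2"] by auto
  have "c * (e / 2) * t > 0" using \<open>c > 0\<close> \<open>e > 0\<close> t by simp
  then obtain N where N: "\<And>k l. N \<le> k \<Longrightarrow> N \<le> l \<Longrightarrow> V k - V l < c * (e / 2) * t"
    using descent_values_Cauchy[OF V] by blast
  have "R k < e" if "k \<ge> N" for k
  proof (rule ccontr)
    assume Rk: "\<not> R k < e"
    define l where "l = (LEAST l. l \<ge> k \<and> R l < e / 2)"
    have "\<exists>l. l \<ge> k \<and> R l < e / 2" using small[of "e / 2" k] \<open>e > 0\<close> by auto
    then have l: "l \<ge> k" "R l < e / 2" unfolding l_def by (metis (mono_tags, lifting) LeastI)+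
    have "R j \<ge> e / 2" if "k \<le> j" "j < l" for j
      using not_less_Least[of j "\<lambda>l. l \<ge> k \<and> R l < e / 2"] that by (auto simp: l_def)
    then have "c * (e / 2) * dist (x l) (x k) \<le> V k - V l"
      using residual_weighted_path_length[where V = V and R = R and x = x, OF descent _ l(1), of "e / 2"] \<open>c > 0\<close> \<open>e > 0\<close> by simp
    also have "\<dots> < c * (e / 2) * t" using N that l by simp
    finally have "dist (x l) (x k) < t" using \<open>c > 0\<close> \<open>e > 0\<close> by simp
    then show False using t(2)[of l k] l Rk by (simp add: abs_if split: if_splits)
  qed
  then show "\<exists>N. \<forall>k\<ge>N. norm (R k - 0) < e" using R by auto
qed


section \<open>Convergence of the residuals\<close>

text \<open>
  Successful and very successful steps are treated alike: neither increases the regularization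
  parameter, so the parameters stay bounded once large ones lead to acceptance.
\<close>

lemma rpqn_step_cases:
  assumes step: "rpqn_step f f' \<phi> p c c' \<sigma>\<^sub>1 \<sigma>\<^sub>2 B d x \<mu> x' \<mu>'"
    and "p > 0" "0 < \<sigma>\<^sub>1" "\<sigma>\<^sub>1 < 1" "\<mu> > 0"
  obtains (accepted) "accepted f f' \<phi> p c B d x \<mu>" "x' = x + d" "0 < \<mu>'" "\<mu>' \<le> \<mu>"
  | (rejected) "\<not> accepted f f' \<phi> p c B d x \<mu>" "x' = x" "\<mu>' = \<sigma>\<^sub>2 * \<mu>"
proof -
  let ?pred = "pred_red f f' \<phi> B x d"
  have pos: "?pred > 0" if "?pred > p * norm d * norm (residual f' \<phi> x)"
    using that \<open>p > 0\<close> by (smt (verit) mult_nonneg_nonneg norm_ge_zero)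
  have ratio: "actual_red f \<phi> x d / ?pred \<le> c \<longleftrightarrow> \<not> actual_red f \<phi> x d > c * ?pred"
    if "?pred > p * norm d * norm (residual f' \<phi> x)"
    using pos[OF that] by (simp add: divide_le_eq not_less)
  show ?thesis
  proof (cases "accepted f f' \<phi> p c B d x \<mu>")
    case True
    then have "x' = x + d \<and> (\<mu>' = \<mu> \<or> \<mu>' = \<sigma>\<^sub>1 * \<mu>)"
      using step ratio unfolding rpqn_step_def Let_def accepted_def
      by (auto split: if_splits)
    moreover have "0 < \<sigma>\<^sub>1 * \<mu>" "\<sigma>\<^sub>1 * \<mu> \<le> \<mu>" using assms by auto
    ultimately show ?thesis using True assms by (intro that(1)) auto
  next
    case False
    then have "x' = x \<and> \<mu>' = \<sigma>\<^sub>2 * \<mu>"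
      using step ratio unfolding rpqn_step_def Let_def accepted_def
      by (auto split: if_splits)
    then show ?thesis using False by (intro that(2)) auto
  qed
qed

lemma rpqn_step_solves:
  assumes "rpqn_step f f' \<phi> p c c' \<sigma>\<^sub>1 \<sigma>\<^sub>2 B d x \<mu> x' \<mu>'" "\<exists>s. solves_subproblem f f' \<phi> B \<mu> x s"
  shows "solves_subproblem f f' \<phi> B \<mu> x d"
  using assms by (simp add: rpqn_step_def Let_def)

lemma rpqn_step_descent:
  assumes step: "rpqn_step f f' \<phi> p c c' \<sigma>\<^sub>1 \<sigma>\<^sub>2 B d x \<mu> x' \<mu>'"
    and "p > 0" "c > 0" "0 < \<sigma>\<^sub>1" "\<sigma>\<^sub>1 < 1" "\<mu> > 0"
  shows "(f x + \<phi> x) - (f x' + \<phi> x') \<ge> c * p * norm (residual f' \<phi> x) * dist x' x"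
  using step \<open>p > 0\<close> \<open>0 < \<sigma>\<^sub>1\<close> \<open>\<sigma>\<^sub>1 < 1\<close> \<open>\<mu> > 0\<close>
proof (cases rule: rpqn_step_cases)
  case accepted
  have "c * p * norm (residual f' \<phi> x) * dist x' x = c * (p * norm d * norm (residual f' \<phi> x))"
    using accepted by (simp add: dist_norm)
  also have "\<dots> \<le> c * pred_red f f' \<phi> B x d"
    using accepted(1) \<open>c > 0\<close> by (intro mult_left_mono) (auto simp: accepted_def)
  also have "\<dots> \<le> actual_red f \<phi> x d" using accepted(1) by (simp add: accepted_def)
  finally show ?thesis using accepted by (simp add: actual_red_def)
qed simp

lemma regularization_pos:
  assumes seq: "rpqn_sequence f f' \<phi> p c c' \<sigma>\<^sub>1 \<sigma>\<^sub>2 B d x \<mu>"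
    and "p > 0" "0 < \<sigma>\<^sub>1" "\<sigma>\<^sub>1 < 1" "1 < \<sigma>\<^sub>2" "\<mu> 0 > 0"
  shows "\<mu> k > 0"
proof (induction k)
  case (Suc k)
  have "rpqn_step f f' \<phi> p c c' \<sigma>\<^sub>1 \<sigma>\<^sub>2 (B k) (d k) (x k) (\<mu> k) (x (Suc k)) (\<mu> (Suc k))"
    using seq by (simp add: rpqn_sequence_def)
  then show ?case
    using \<open>p > 0\<close> \<open>0 < \<sigma>\<^sub>1\<close> \<open>\<sigma>\<^sub>1 < 1\<close> Suc
    by (cases rule: rpqn_step_cases) (use \<open>1 < \<sigma>\<^sub>2\<close> Suc in auto)
qed (rule assms)

text \<open>
  If the residual stayed above \<open>\<epsilon>\<close>, the iterates would form a Cauchy sequence. Near their limit the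
  parameters are bounded because steps with a large parameter are accepted, whereas short
  steps with a bounded parameter are rejected; so eventually every step would be
  rejected and the parameters would be multiplied by \<open>\<sigma>\<^sub>2 > 1\<close> forever.
\<close>

lemma residual_frequently_small:
  fixes f \<phi> :: "real^'n \<Rightarrow> real"
  assumes gradient: "\<And>y. GDERIV f y :> f' y"
    and C1: "continuous_on UNIV f'"
    and convex: "convex_on UNIV \<phi>"
    and p: "0 < p" "p < 1/2" and c: "0 < c" "c < 1/2"
    and \<sigma>: "0 < \<sigma>\<^sub>1" "\<sigma>\<^sub>1 < 1" "1 < \<sigma>\<^sub>2" and mu0: "\<mu> 0 > 0"
    and seq: "rpqn_sequence f f' \<phi> p c c' \<sigma>\<^sub>1 \<sigma>\<^sub>2 B d x \<mu>"
    and sym: "\<And>k. transpose (B k) = B k"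
    and \<beta>: "\<And>k v. norm (B k *v v) \<le> \<beta> * norm v" "\<beta> \<ge> 0"
    and below: "bdd_below (range (\<lambda>y. f y + \<phi> y))"
    and "\<epsilon> > 0"
  shows "\<exists>k\<ge>K. norm (residual f' \<phi> (x k)) < \<epsilon>"
proof (rule ccontr)
  assume "\<not> ?thesis"
  then have away: "norm (residual f' \<phi> (x k)) \<ge> \<epsilon>" if "k \<ge> K" for k
    using that by (metis not_less)
  have step: "rpqn_step f f' \<phi> p c c' \<sigma>\<^sub>1 \<sigma>\<^sub>2 (B k) (d k) (x k) (\<mu> k) (x (Suc k)) (\<mu> (Suc k))" for k
    using seq by (simp add: rpqn_sequence_def)
  have pos: "\<mu> k > 0" for k
    using regularization_pos[where k = k and \<mu> = \<mu>, OF seq p(1) \<sigma> mu0] .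
  define V where "V k = f (x k) + \<phi> (x k)" for k
  have descent: "V k - V (Suc k) \<ge> c * p * norm (residual f' \<phi> (x k)) * dist (x (Suc k)) (x k)" for k
    unfolding V_def by (rule rpqn_step_descent[OF step p(1) c(1) \<sigma>(1,2) pos])
  have "V (Suc k) \<le> V k" for k
  proof -
    have "0 \<le> c * p * norm (residual f' \<phi> (x k)) * dist (x (Suc k)) (x k)" using c p by simp
    then show ?thesis using descent[of k] by linarith
  qed
  then have "decseq V" by (rule decseq_SucI)
  moreover have "bdd_below (range V)"
    using below by (rule bdd_below_mono) (auto simp: V_def)
  ultimately have "Cauchy x"
    using Cauchy_if_residual_bounded_away[where V = V and R = "\<lambda>k. norm (residual f' \<phi> (x k))" and x = x,
        OF descent _ _ _ \<open>\<epsilon> > 0\<close> away] c p by simp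
  then obtain z where z: "x \<longlonglongrightarrow> z" using Cauchy_convergent_iff convergent_def by blast

  obtain \<delta> M where M\<delta>: "\<delta> > 0" "M > \<beta>"
    and pass: "\<forall>B \<mu> x d. transpose B = B \<longrightarrow> (\<forall>v. norm (B *v v) \<le> \<beta> * norm v) \<longrightarrow>
     dist x z < \<delta> \<longrightarrow> norm (residual f' \<phi> x) \<ge> \<epsilon> \<longrightarrow> \<mu> \<ge> M \<longrightarrow> solves_subproblem f f' \<phi> B \<mu> x d \<longrightarrow>
     accepted f f' \<phi> p c B d x \<mu>"
    using accepted_near_point[OF gradient C1 convex p c(2) \<beta>(2) \<open>\<epsilon> > 0\<close>, of z] by metis
  obtain N\<^sub>0 where N\<^sub>0: "\<And>k. k \<ge> N\<^sub>0 \<Longrightarrow> dist (x k) z < \<delta>"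
    using metric_LIMSEQ_D[OF z M\<delta>(1)] by blast
  define N where "N = max N\<^sub>0 K"
  have acc: "accepted f f' \<phi> p c (B k) (d k) (x k) (\<mu> k)" if "k \<ge> N" "\<mu> k \<ge> M" for k
  proof -
    have "\<mu> k > \<beta>" using that M\<delta> by linarith
    then have sol: "solves_subproblem f f' \<phi> (B k) (\<mu> k) (x k) (d k)"
      using rpqn_step_solves[OF step] regularized_subproblem_solvable[OF convex \<beta>(1)] by blast
    show ?thesis
      using pass[rule_format, OF sym \<beta>(1) N\<^sub>0 away _ sol] that by (simp add: N_def)
  qed

  \<comment> \<open>A parameter increases only while it is below \<open>M\<close>, and then at most by the factor \<open>\<sigma>\<^sub>2\<close>.\<close>
  define C where "C = max (\<mu> N) (\<sigma>\<^sub>2 * M)"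
  have \<mu>_le: "\<mu> k \<le> C" if "k \<ge> N" for k
    using that
  proof (induction k rule: dec_induct)
    case (step k)
    from \<open>\<And>k. rpqn_step f f' \<phi> p c c' \<sigma>\<^sub>1 \<sigma>\<^sub>2 (B k) (d k) (x k) (\<mu> k) (x (Suc k)) (\<mu> (Suc k))\<close>[of k]
      p(1) \<sigma>(1,2) pos[of k] show ?case
    proof (cases rule: rpqn_step_cases)
      case rejected
      then have "\<mu> k < M" using acc[of k] step by force
      then have "\<sigma>\<^sub>2 * \<mu> k \<le> \<sigma>\<^sub>2 * M" using \<sigma> by simp
      then show ?thesis using rejected by (simp add: C_def)
    qed (use step in simp)
  qed (simp add: C_def)

  \<comment> \<open>An accepted step of length less than \<open>t\<close> would have a residual smaller than \<open>\<epsilon>\<close>.\<close>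
  have C: "C > 0" using \<mu>_le[of N] pos[of N] by linarith
  define t where "t = \<epsilon> / (2 * (1 + \<beta> + C))"
  have "t > 0" using C \<open>\<epsilon> > 0\<close> \<beta>(2) by (simp add: t_def)
  then obtain N\<^sub>1 where N\<^sub>1: "\<And>k l. k \<ge> N\<^sub>1 \<Longrightarrow> l \<ge> N\<^sub>1 \<Longrightarrow> dist (x k) (x l) < t"
    using \<open>Cauchy x\<close> unfolding Cauchy_def by blast
  define N\<^sub>2 where "N\<^sub>2 = max N N\<^sub>1"
  have grow: "\<mu> (Suc k) = \<sigma>\<^sub>2 * \<mu> k" if k: "k \<ge> N\<^sub>2" for k
    using step[of k] p(1) \<sigma>(1,2) pos[of k]
  proof (cases rule: rpqn_step_cases)
    case accepted
    have kN: "k \<ge> N" "k \<ge> K" "k \<ge> N\<^sub>1" using k by (auto simp: N\<^sub>2_def N_def)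
    have "norm (d k) < t"
      using N\<^sub>1[of "Suc k" k] kN accepted(2) by (simp add: dist_norm)
    have "\<epsilon> \<le> 2 * (1 + \<beta> + \<mu> k) * norm (d k)"
      using residual_le_direction[OF convex sym \<beta>(1) less_imp_le[OF pos] \<beta>(2)] accepted(1) away[OF kN(2)]
      by (meson accepted_def order_trans)
    also have "\<dots> \<le> 2 * (1 + \<beta> + C) * norm (d k)"
      using \<mu>_le[OF kN(1)] by (intro mult_right_mono) auto
    also have "\<dots> < 2 * (1 + \<beta> + C) * t"
      using \<open>norm (d k) < t\<close> C \<beta>(2) by (intro mult_strict_left_mono) auto
    also have "\<dots> = \<epsilon>" using C \<beta>(2) by (simp add: t_def)
    finally show ?thesis by simp
  qed simp
  have power: "\<mu> (N\<^sub>2 + m) = \<sigma>\<^sub>2 ^ m * \<mu> N\<^sub>2" for m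
    by (induction m) (simp_all add: grow)
  obtain m where "C / \<mu> N\<^sub>2 < \<sigma>\<^sub>2 ^ m" using real_arch_pow[OF \<sigma>(3)] by blast
  then have "C < \<mu> (N\<^sub>2 + m)" using pos[of N\<^sub>2] by (simp add: power divide_less_eq)
  moreover have "\<mu> (N\<^sub>2 + m) \<le> C" by (rule \<mu>_le) (simp add: N\<^sub>2_def)
  ultimately show False by simp
qed

lemma bounded_matrices_uniform_bound:
  fixes B :: "nat \<Rightarrow> real^'n^'n"
  assumes "bounded (range B)"
  obtains \<beta> where "\<beta> \<ge> 0" "\<And>k v. norm (B k *v v) \<le> \<beta> * norm v"
proof -
  obtain b where b: "\<And>k. norm (B k) \<le> b" using assms by (auto simp: bounded_iff)
  define \<beta> where "\<beta> = real CARD('n) * real CARD('n) * b"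
  have "onorm ((*v) (B k)) \<le> \<beta>" for k
    unfolding \<beta>_def
  proof (rule onorm_le_matrix_component)
    show "\<bar>B k $ i $ j\<bar> \<le> b" for i j
      using component_le_norm_cart[of "B k $ i" j] Finite_Cartesian_Product.norm_nth_le[of "B k" i] b[of k] by linarith
  qed
  then have "norm (B k *v v) \<le> \<beta> * norm v" for k v
    using onorm[OF matrix_vector_mul_bounded_linear, of "B k" v]
    by (meson mult_right_mono norm_ge_zero order_trans)
  moreover have "b \<ge> 0" using b[of 0] norm_ge_zero order_trans by blast
  then have "\<beta> \<ge> 0" by (simp add: \<beta>_def)
  ultimately show ?thesis using that by blast
qed

theorem theorem4p6:
  fixes f \<phi> :: "real^'n \<Rightarrow> real"
    and f' :: "real^'n \<Rightarrow> real^'n"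
    and p_min c\<^sub>1 c\<^sub>2 \<sigma>\<^sub>1 \<sigma>\<^sub>2 :: real
    and B :: "nat \<Rightarrow> real^'n^'n"
    and d x :: "nat \<Rightarrow> real^'n"
    and \<mu> :: "nat \<Rightarrow> real"
    and X :: "(real^'n) set"
  assumes gradient: "\<And>y. GDERIV f y :> f' y"
    and C1: "continuous_on UNIV f'"
    and convex: "convex_on UNIV \<phi>"
    and mu0: "\<mu> 0 > 0"
    and p_min: "0 < p_min" "p_min < 1/2"
    and c1: "0 < c\<^sub>1" "c\<^sub>1 < 1/2"
    and c2: "c\<^sub>1 < c\<^sub>2" "c\<^sub>2 < 1"
    and sigma1: "0 < \<sigma>\<^sub>1" "\<sigma>\<^sub>1 < 1"
    and sigma2: "1 < \<sigma>\<^sub>2"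
    and generated: "rpqn_sequence f f' \<phi> p_min c\<^sub>1 c\<^sub>2 \<sigma>\<^sub>1 \<sigma>\<^sub>2 B d x \<mu>"
    and not_stationary: "\<And>k. \<not> stationary_point f' \<phi> (x k)"
    and B_symmetric: "\<And>k. transpose (B k) = B k"
    and B_bounded: "bounded (range B)"
    and psi_bounded_below: "bdd_below (range (\<lambda>y. f y + \<phi> y))"
    and iterates: "range x \<subseteq> X"
    and unif_cont: "uniformly_continuous_on X f'"
  shows "(\<lambda>k. norm (residual f' \<phi> (x k))) \<longlonglongrightarrow> 0 \<and>
         (\<forall>y. (\<exists>s. strict_mono s \<and> (x \<circ> s) \<longlonglongrightarrow> y) \<longrightarrow> stationary_point f' \<phi> y)"
proof -
  let ?R = "\<lambda>y. norm (residual f' \<phi> y)"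
  obtain \<beta> where \<beta>: "\<beta> \<ge> 0" "\<And>k v. norm (B k *v v) \<le> \<beta> * norm v"
    using bounded_matrices_uniform_bound[OF B_bounded] by blast
  define V where "V k = f (x k) + \<phi> (x k)" for k
  have pos: "\<mu> k > 0" for k
    using regularization_pos[where k = k and \<mu> = \<mu>, OF generated p_min(1) sigma1 sigma2 mu0] .
  have descent: "V k - V (Suc k) \<ge> (c\<^sub>1 * p_min) * ?R (x k) * dist (x (Suc k)) (x k)" for k
    unfolding V_def
    by (rule rpqn_step_descent[OF _ p_min(1) c1(1) sigma1 pos])
      (use generated in \<open>auto simp: rpqn_sequence_def\<close>)
  have cp: "c\<^sub>1 * p_min > 0" using c1 p_min by simp
  have "V (Suc k) \<le> V k" for k
  proof -
    have "0 \<le> (c\<^sub>1 * p_min) * ?R (x k) * dist (x (Suc k)) (x k)" using cp by simp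
    then show ?thesis using descent[of k] by linarith
  qed
  then have V_dec: "decseq V" by (rule decseq_SucI)
  have V_below: "bdd_below (range V)"
    using psi_bounded_below by (rule bdd_below_mono) (auto simp: V_def)
  have small: "\<exists>k\<ge>K. ?R (x k) < e" if "e > 0" for e K
    using residual_frequently_small[OF gradient C1 convex p_min c1 sigma1 sigma2 mu0 generated
        B_symmetric \<beta>(2,1) psi_bounded_below that] .
  have R_diff: "\<bar>?R u - ?R v\<bar> \<le> dist (f' u) (f' v) + 2 * dist u v" for u v
    using residual_diff_le[OF convex, of f' u v] norm_triangle_ineq3[of "residual f' \<phi> u" "residual f' \<phi> v"]
    by (simp add: dist_norm)
  have uc: "\<exists>t>0. \<forall>i j. dist (x i) (x j) < t \<longrightarrow> \<bar>?R (x i) - ?R (x j)\<bar> < e" if "e > 0" for e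
  proof -
    obtain t where t: "t > 0" "\<And>u v. u \<in> X \<Longrightarrow> v \<in> X \<Longrightarrow> dist u v < t \<Longrightarrow> dist (f' u) (f' v) < e / 2"
      using unif_cont \<open>e > 0\<close> unfolding uniformly_continuous_on_def
      by (metis dist_commute half_gt_zero)
    have "\<bar>?R (x i) - ?R (x j)\<bar> < e" if "dist (x i) (x j) < min t (e / 4)" for i j
    proof -
      have "dist (f' (x i)) (f' (x j)) < e / 2" using t(2)[of "x i" "x j"] iterates that by auto
      then show ?thesis using R_diff[of "x i" "x j"] that by simp
    qed
    then show ?thesis using t(1) \<open>e > 0\<close> by (intro exI[of _ "min t (e / 4)"]) auto
  qed
  have lim: "(\<lambda>k. ?R (x k)) \<longlonglongrightarrow> 0"
    by (rule residual_tendsto_zero[where V = V and R = "\<lambda>k. ?R (x k)" and x = x, OF descent cp V_dec V_below])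
      (use small uc in auto)
  moreover have "stationary_point f' \<phi> y" if s: "strict_mono s" "(x \<circ> s) \<longlonglongrightarrow> y" for y s
  proof (rule stationary_point_if_residual_zero[OF convex])
    have xs: "(\<lambda>k. x (s k)) \<longlonglongrightarrow> y" using s(2) by (simp add: o_def)
    have "isCont f' y" using C1 by (simp add: continuous_on_eq_continuous_at)
    then have "(\<lambda>k. f' (x (s k))) \<longlonglongrightarrow> f' y" using xs by (rule isCont_tendsto_compose)
    then have "(\<lambda>k. dist (f' (x (s k))) (f' y)) \<longlonglongrightarrow> 0" by (rule tendsto_dist_iff[THEN iffD1])
    moreover have "(\<lambda>k. dist (x (s k)) y) \<longlonglongrightarrow> 0" using xs by (rule tendsto_dist_iff[THEN iffD1])
    ultimately have "(\<lambda>k. dist (f' (x (s k))) (f' y) + 2 * dist (x (s k)) y) \<longlonglongrightarrow> 0"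
      by (intro tendsto_add_zero tendsto_mult_right_zero)
    then have "(\<lambda>k. ?R (x (s k)) - ?R y) \<longlonglongrightarrow> 0"
      by (rule Lim_null_comparison[rotated]) (simp add: R_diff)
    then have "(\<lambda>k. ?R (x (s k))) \<longlonglongrightarrow> ?R y" by (simp add: LIM_zero_iff)
    moreover have "(\<lambda>k. ?R (x (s k))) \<longlonglongrightarrow> 0"
      using LIMSEQ_subseq_LIMSEQ[OF lim s(1)] by (simp add: o_def)
    ultimately have "?R y = 0" by (rule LIMSEQ_unique)
    then show "residual f' \<phi> y = 0" by simp
  qed
  ultimately show ?thesis by blast
qed

end
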